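(* Let $q=p^h$ with $p$ prime, and let $L$ be an $\mathbb{F}_p$-linear set of rank $hm$ in $\mathrm{PG}(m,q)$. Then \[|L|\leq q^{m-1}\frac{q-1}{p-1}+\frac{q^{m-1}-1}{q-1}.\]
   Context: Let $V=\mathbb{F}_q^{m+1}$ be the vector space underlying $\mathrm{PG}(m,q)$, viewed also as an $\mathbb{F}_p$-vector space. An $\mathbb{F}_p$-linear set of rank $r$ is a set of the form $L_U=\{\langle u\rangle_{\mathbb{F}_q}: u\in U\setminus\{0\}\}$ where $U$ is an $r$-dimensional $\mathbb{F}_p$-subspace of $V$. *)

theory Defs
  imports "HOL-Analysis.Analysis" "Berlekamp_Zassenhaus.Finite_Field"
begin

text \<open>
  The prime field \<open>\<bbbF>\<^sub>p\<close> is the type \<open>'p mod_ring\<close> of residues modulo \<open>p = CARD('p)\<close>.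
  It acts on a vector space over a field \<open>'a\<close> of order \<open>p ^ h\<close> through the embedding
  of \<open>\<bbbF>\<^sub>p\<close> into \<open>'a\<close>, which sends a residue to the image of its integer representative.
  For other fields \<open>'a\<close> the definition is meaningless.
\<close>

definition fp_scale :: "'p::prime_card mod_ring \<Rightarrow> 'a::field ^ 'n \<Rightarrow> 'a ^ 'n" where
  "fp_scale c v = of_int (to_int_mod_ring c) *s v"

lemma vector_space_fp_scale:
  assumes "CARD('a::{field,finite}) = CARD('p::prime_card) ^ h"
  shows "vector_space (fp_scale :: 'p mod_ring \<Rightarrow> 'a ^ 'n \<Rightarrow> 'a ^ 'n)"
proof -
  have "prime CHAR('a)"
    by (intro prime_CHAR_semidom finite_imp_CHAR_pos) simp
  moreover have "CHAR('a) dvd CARD('p) ^ h"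
    using CHAR_dvd_CARD[where 'a = 'a] assms by simp
  ultimately have "CHAR('a) = CARD('p)"
    using prime_card[where 'a = 'p] by (meson prime_dvd_power primes_dvd_imp_eq)
  then have [simp]: "of_int (k mod int CARD('p)) = (of_int k :: 'a)" for k
    by (metis of_int_eq_iff_cong_CHAR cong_mod_left cong_refl)
  show ?thesis
    by unfold_locales
      (simp_all add: fp_scale_def to_int_mod_ring_add to_int_mod_ring_mult
        vector_add_ldistrib vector_sadd_rdistrib vector_smult_assoc)
qed

text \<open>
  Points of \<open>PG(m, q)\<close> are the one-dimensional subspaces of \<open>'a ^ 'n\<close>, where
  \<open>CARD('n) = m + 1\<close>; \<open>vec.span\<close> is the span over \<open>'a\<close>.
\<close>

definition points_of :: "('a::field ^ 'n) set \<Rightarrow> ('a ^ 'n) set set" where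
  "points_of U = {vec.span {u} | u. u \<in> U - {0}}"

definition fp_linear_set ::
  "'p::prime_card itself \<Rightarrow> nat \<Rightarrow> ('a::field ^ 'n) set set \<Rightarrow> bool" where
  "fp_linear_set _ r L \<longleftrightarrow>
    (\<exists>U. module.subspace (fp_scale :: 'p mod_ring \<Rightarrow> _) U \<and>
         vector_space.dim (fp_scale :: 'p mod_ring \<Rightarrow> _) U = r \<and>
         L = points_of U)"

end

theory Submission
  imports Defs
begin

text \<open>
  The bound follows by duality. If \<open>L\<close> comes from \<open>U\<close> with \<open>m > 0\<close>, there are \<open>q\<close> functionals
  over the prime field that vanish on \<open>U\<close>. For such a functional \<open>f \<noteq> 0\<close>, the vectors whose
  whole line over \<open>'a\<close> lies in the kernel of \<open>f\<close> form a hyperplane, and proportional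
  functionals give the same one, so at most \<open>(q - 1) / (p - 1)\<close> hyperplanes arise. If \<open>P\<close> is a
  point of \<open>L\<close>, then \<open>U \<inter> P \<noteq> 0\<close>, hence \<open>U + P\<close> is a proper subspace by counting, some
  \<open>f \<noteq> 0\<close> vanishes on it, and \<open>P\<close> lies in the hyperplane of \<open>f\<close>. The first hyperplane covers
  \<open>(q ^ m - 1) / (q - 1)\<close> points, and each further one adds at most \<open>q ^ (m - 1)\<close>.
\<close>

section \<open>Finite vector spaces: sizes of spans and of annihilators\<close>

context vector_space
begin

text \<open>Each element of the span has unique coefficients on \<open>B\<close>. Taking the
  coefficient functions in \<open>PiE\<close> makes them undefined outside \<open>B\<close>, so that
  they can be counted.\<close>

lemma card_span_independent:
  assumes fin: "finite (UNIV :: 'a set)" and "finite B" "independent B"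
  shows "card (span B) = CARD('a) ^ card B"
proof -
  have "inj_on (\<lambda>u. \<Sum>v\<in>B. u v *s v) (B \<rightarrow>\<^sub>E UNIV)"
  proof (rule inj_onI)
    fix u w assume u: "u \<in> B \<rightarrow>\<^sub>E UNIV" and w: "w \<in> B \<rightarrow>\<^sub>E UNIV"
      and eq: "(\<Sum>v\<in>B. u v *s v) = (\<Sum>v\<in>B. w v *s v)"
    have "(\<Sum>v\<in>B. (u v - w v) *s v) = 0"
      using eq by (simp add: scale_left_diff_distrib sum_subtractf)
    then have "u v - w v = 0" if "v \<in> B" for v
      using independentD[of B B "\<lambda>v. u v - w v"] assms that by blast
    then show "u = w"
      using u w by (intro PiE_ext) auto
  qed
  moreover have "(\<lambda>u. \<Sum>v\<in>B. u v *s v) ` (B \<rightarrow>\<^sub>E UNIV) = span B"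
  proof -
    have "(\<Sum>v\<in>B. u v *s v) \<in> (\<lambda>u. \<Sum>v\<in>B. u v *s v) ` (B \<rightarrow>\<^sub>E UNIV)" for u
      by (rule image_eqI[of _ _ "restrict u B"]) (simp_all cong: sum.cong)
    then show ?thesis
      unfolding span_finite[OF \<open>finite B\<close>] by blast
  qed
  ultimately have "card (span B) = card (B \<rightarrow>\<^sub>E (UNIV :: 'a set))"
    using card_image by fastforce
  then show ?thesis
    using \<open>finite B\<close> by (simp add: card_PiE)
qed

lemma card_subspace_eq_power_dim:
  assumes "finite (UNIV :: 'a set)" "finite U" "subspace U"
  shows "card U = CARD('a) ^ dim U"
proof -
  obtain B where B: "B \<subseteq> U" "independent B" "U \<subseteq> span B" "card B = dim U"
    by (rule basis_exists)
  then have "span B = U"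
    using assms span_minimal by blast
  then show ?thesis
    using card_span_independent[of B] B assms finite_subset by metis
qed

text \<open>Extend a basis \<open>B\<close> of \<open>U\<close> to a basis \<open>C\<close> of the
  whole space. A functional vanishing on \<open>U\<close> is 0 on \<open>B\<close> and arbitrary on
  \<open>C - B\<close>, so its restriction to \<open>C - B\<close> determines it. The product form
  avoids division.\<close>

lemma card_functionals_vanishing_on:
  assumes finF: "finite (UNIV :: 'a set)" and finV: "finite (UNIV :: 'b set)" and U: "subspace U"
  shows "card {f. Vector_Spaces.linear scale (*) f \<and> (\<forall>u\<in>U. f u = 0)} * card U = CARD('b)"
proof -
  interpret F: vector_space_pair scale "(*) :: 'a \<Rightarrow> 'a \<Rightarrow> 'a"
    by (intro vector_space_pair.intro vector_space_axioms
        vector_space_over_itself.vector_space_axioms)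
  let ?A = "{f. Vector_Spaces.linear scale (*) f \<and> (\<forall>u\<in>U. f u = 0)}"
  obtain B where B: "B \<subseteq> U" "independent B" "U \<subseteq> span B" "card B = dim U"
    by (rule basis_exists)
  then have spB: "span B = U"
    using U span_minimal by blast
  obtain C where C: "B \<subseteq> C" "C \<subseteq> UNIV" "independent C" "UNIV \<subseteq> span C"
    by (rule maximal_independent_subset_extend[OF subset_UNIV B(2)])
  have fin: "finite X" for X :: "'b set"
    using finite_subset[OF subset_UNIV finV] .
  have bij: "bij_betw (\<lambda>f. restrict f (C - B)) ?A ((C - B) \<rightarrow>\<^sub>E UNIV)"
    unfolding bij_betw_def
  proof
    show "inj_on (\<lambda>f. restrict f (C - B)) ?A"
    proof (rule inj_onI)
      fix f g assume f: "f \<in> ?A" and g: "g \<in> ?A"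
        and eq: "restrict f (C - B) = restrict g (C - B)"
      have "f b = g b" if "b \<in> C" for b
      proof (cases "b \<in> B")
        case True
        then have "b \<in> U" using B(1) by blast
        then show ?thesis using f g by simp
      next
        case False
        then show ?thesis using that fun_cong[OF eq, of b] by simp
      qed
      then have "f x = g x" for x
        using F.linear_eq_on[of f g x C] f g subsetD[OF C(4) UNIV_I] by blast
      then show "f = g" ..
    qed
    have "g \<in> (\<lambda>f. restrict f (C - B)) ` ?A" if g: "g \<in> (C - B) \<rightarrow>\<^sub>E UNIV" for g
    proof -
      obtain f where f: "Vector_Spaces.linear scale (*) f"
        "\<And>x. x \<in> C \<Longrightarrow> f x = (if x \<in> B then 0 else g x)"
        using F.linear_independent_extend[OF C(3), of "\<lambda>x. if x \<in> B then 0 else g x"] by blast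
      interpret f: Vector_Spaces.linear scale "(*)" f by fact
      have "f b = 0" if "b \<in> B" for b
        using f(2)[of b] that C(1) by auto
      then have "f u = 0" if "u \<in> U" for u
        using f.eq_0_on_span[of B u] that spB by blast
      moreover have "g = restrict f (C - B)"
      proof
        show "g x = restrict f (C - B) x" for x
          using f(2)[of x] PiE_arb[OF g, of x] by (cases "x \<in> C - B") auto
      qed
      ultimately show ?thesis
        using f(1) by blast
    qed
    then show "(\<lambda>f. restrict f (C - B)) ` ?A = ((C - B) \<rightarrow>\<^sub>E UNIV)"
      by (intro equalityI image_subsetI subsetI) (simp add: restrict_PiE_iff, blast)
  qed
  have "card ?A = CARD('a) ^ card (C - B)"
    unfolding bij_betw_same_card[OF bij] by (simp add: card_PiE fin)
  moreover have "card U = CARD('a) ^ card B"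
    using card_span_independent[OF finF fin B(2)] spB by simp
  moreover have "CARD('b) = CARD('a) ^ card C"
    using card_span_independent[OF finF fin C(3)] C(4) by (simp add: top_unique)
  moreover have "card C = card (C - B) + card B"
    using C(1) fin[of B] fin[of C] card_mono[of C B] by (simp add: card_Diff_subset)
  ultimately show ?thesis
    by (simp add: power_add)
qed

end

section \<open>Counting fibres, unions and points\<close>

text \<open>Subtracting a fixed element of a fibre maps the fibre injectively into the one over
  \<open>f 0\<close>. The first hypothesis stands in for additivity, so that the values of
  \<open>f\<close> may be pairs of functions without a group structure.\<close>

lemma card_le_card_kernel_times:
  fixes f :: "'g::{ab_group_add,finite} \<Rightarrow> 'k"
  assumes "\<And>x y. f x = f y \<Longrightarrow> f (x - y) = f 0"
    and T: "range f \<subseteq> T" "finite T"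
  shows "CARD('g) \<le> card {x. f x = f 0} * card T"
proof -
  have "card {x. f x = t} \<le> card {x. f x = f 0}" for t
  proof (cases "\<exists>y. f y = t")
    case True
    then obtain y where "f y = t" by blast
    then have "(\<lambda>x. x - y) ` {x. f x = t} \<subseteq> {x. f x = f 0}"
      using assms(1) by auto
    then show ?thesis
      by (intro card_inj_on_le[of "\<lambda>x. x - y"]) (auto simp: inj_on_def)
  qed simp
  then have "(\<Sum>t\<in>T. card {x. f x = t}) \<le> (\<Sum>t\<in>T. card {x. f x = f 0})"
    by (rule sum_mono)
  moreover have "(UNIV :: 'g set) = (\<Union>t\<in>T. {x. f x = t})"
    using T by auto
  then have "CARD('g) \<le> (\<Sum>t\<in>T. card {x. f x = t})"
    using card_UN_le[OF T(2), of "\<lambda>t. {x. f x = t}"] by simp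
  ultimately show ?thesis
    by (simp add: mult.commute)
qed

text \<open>Start from \<open>H0\<close>; every other member contributes only what lies outside
  \<open>H0\<close>, which is at most \<open>a - b\<close> elements.\<close>

lemma card_Union_le:
  fixes F :: "'b set set" and H0 :: "'b set"
  assumes "finite F" "H0 \<in> F" "\<And>H. H \<in> F \<Longrightarrow> finite H \<and> card H \<le> a"
    "\<And>H. H \<in> F \<Longrightarrow> b \<le> card (H \<inter> H0)"
  shows "card (\<Union>F) \<le> a + (card F - 1) * (a - b)"
proof -
  have "\<Union>F = H0 \<union> (\<Union>H\<in>F - {H0}. H - H0)"
    using assms(2) by auto
  then have "card (\<Union>F) \<le> card H0 + card (\<Union>H\<in>F - {H0}. H - H0)"
    using card_Un_le by metis
  also have "card (\<Union>H\<in>F - {H0}. H - H0) \<le> (\<Sum>H\<in>F - {H0}. card (H - H0))"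
    using assms(1) by (intro card_UN_le) auto
  also have "\<dots> \<le> (\<Sum>H\<in>F - {H0}. a - b)"
  proof (rule sum_mono)
    fix H assume H: "H \<in> F - {H0}"
    then have "card (H - H0) = card H - card (H \<inter> H0)"
      using assms(3) by (intro card_Diff_subset_Int) auto
    then show "card (H - H0) \<le> a - b"
      using assms(3)[of H] assms(4)[of H] H by auto
  qed
  also have "\<dots> = (card F - 1) * (a - b)"
    using assms by simp
  finally show ?thesis
    using assms(3)[OF assms(2)] by linarith
qed

text \<open>Distinct points meet only in \<open>0\<close>, so their nonzero vectors can be counted separately.\<close>

lemma card_points_of_le:
  fixes U W :: "('a::{field,finite} ^ 'n) set"
  assumes sub: "\<And>P. P \<in> points_of U \<Longrightarrow> P \<subseteq> W" and "0 \<in> W"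
  shows "card (points_of U) * (CARD('a) - 1) \<le> card W - 1"
proof -
  have line: "card (vec.span {u} - {0}) = CARD('a) - 1" if "u \<noteq> 0" for u :: "'a ^ 'n"
  proof -
    have "card (vec.span {u}) = CARD('a) ^ card {u}"
      using that by (intro vec.card_span_independent) auto
    then show ?thesis
      using vec.span_zero[of "{u}"] by simp
  qed
  have dis: "disjoint_family_on (\<lambda>P. P - {0}) (points_of U)"
    unfolding disjoint_family_on_def
  proof (intro ballI impI)
    fix P Q assume "P \<in> points_of U" "Q \<in> points_of U" "P \<noteq> Q"
    then obtain u v where uv: "P = vec.span {u}" "Q = vec.span {v}"
      by (auto simp: points_of_def)
    \<comment> \<open>Every nonzero vector of a point spans it, so points that share one
      coincide.\<close>
    have eq: "vec.span {w} = vec.span {x}" if "x \<in> vec.span {w}" "x \<noteq> 0" for w x :: "'a ^ 'n"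
    proof -
      obtain c where c: "x = c *s w"
        using \<open>x \<in> _\<close> by (auto simp: vec.span_singleton)
      then have "c \<noteq> 0" using that by auto
      then have "w = inverse c *s x" by (simp add: c)
      then have "w \<in> vec.span {x}"
        by (metis vec.span_base vec.span_scale singletonI)
      then show ?thesis
        using that by (intro antisym vec.span_minimal) auto
    qed
    show "(P - {0}) \<inter> (Q - {0}) = {}"
      using eq \<open>P \<noteq> Q\<close> uv by blast
  qed
  have "card (points_of U) * (CARD('a) - 1) = (\<Sum>P\<in>points_of U. card (P - {0}))"
    by (subst sum.cong[OF refl, of _ _ "\<lambda>_. CARD('a) - 1"]) (auto simp: points_of_def line)
  also have "\<dots> = card (\<Union>P\<in>points_of U. P - {0})"
    using dis by (intro card_UN_disjoint'[symmetric]) auto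
  also have "\<dots> \<le> card (W - {0})"
    using sub by (intro card_mono) auto
  finally show ?thesis
    using \<open>0 \<in> W\<close> by simp
qed

section \<open>The subspace attached to an additive map\<close>

text \<open>For additive \<open>f\<close> this is the largest subspace over \<open>'a\<close> inside
  the kernel of \<open>f\<close>. If \<open>'a\<close> is finite and \<open>f\<close> is the trace
  to the prime field of an \<open>'a\<close>-linear functional, it is the kernel of that functional;
  this form avoids the trace.\<close>

definition line_kernel :: "('a::field ^ 'n \<Rightarrow> 'b::zero) \<Rightarrow> ('a ^ 'n) set" where
  "line_kernel f = {v. \<forall>x. f (x *s v) = 0}"

lemma subspace_line_kernel:
  fixes f :: "'a::field ^ 'n \<Rightarrow> 'b::ab_group_add"
  assumes "\<And>x y. f (x + y) = f x + f y"
  shows "vec.subspace (line_kernel f)"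
proof -
  have "f 0 = 0"
    using assms[of 0 0] by simp
  then show ?thesis
    unfolding vec.subspace_def line_kernel_def
    by (auto simp: assms vector_add_ldistrib vector_smult_assoc)
qed

text \<open>The vector \<open>v\<close> lies outside, so the subspace is proper and has dimension at
  most \<open>CARD('n) - 1\<close>.\<close>

lemma card_line_kernel_le:
  fixes f :: "'a::{field,finite} ^ 'n \<Rightarrow> 'b::ab_group_add"
  assumes "\<And>x y. f (x + y) = f x + f y" and "f v \<noteq> 0"
  shows "card (line_kernel f) \<le> CARD('a) ^ (CARD('n) - 1)"
proof -
  have "v \<notin> line_kernel f"
    using assms(2) by (auto simp: line_kernel_def intro: exI[of _ 1])
  then have "vec.dim (line_kernel f) \<noteq> CARD('n)"
    using vec.dim_eq_full[of "line_kernel f"] subspace_line_kernel[of f, OF assms(1)]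
    by (auto simp: vec.dimension_def card_cart_basis vec.span_eq_iff[THEN iffD2])
  then have "vec.dim (line_kernel f) \<le> CARD('n) - 1"
    using vec.dim_subset_UNIV[of "line_kernel f"]
    by (simp add: vec.dimension_def card_cart_basis)
  then show ?thesis
    using vec.card_subspace_eq_power_dim[OF _ _ subspace_line_kernel[of f, OF assms(1)]]
    by (simp add: power_increasing)
qed

section \<open>Functionals over the prime field and their hyperplanes\<close>

abbreviation fp_linear :: "('a::field ^ 'n \<Rightarrow> 'p::prime_card mod_ring) \<Rightarrow> bool" where
  "fp_linear \<equiv> Vector_Spaces.linear fp_scale (*)"

lemma card_fp_linear_vanishing_on:
  fixes U :: "('a::{field,finite} ^ 'n) set"
  assumes "CARD('a) = CARD('p::prime_card) ^ h"
    and "module.subspace (fp_scale :: 'p mod_ring \<Rightarrow> 'a ^ 'n \<Rightarrow> _) U"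
  shows "card {f :: 'a ^ 'n \<Rightarrow> 'p mod_ring. fp_linear f \<and> (\<forall>u\<in>U. f u = 0)} * card U
    = CARD('a) ^ CARD('n)"
  using vector_space.card_functionals_vanishing_on[OF vector_space_fp_scale[OF assms(1)] _ _ assms(2)]
  by simp

text \<open>The field \<open>'a\<close> is taken as the space \<open>'a ^ 1\<close>, so that \<open>fp_scale\<close> makes it a space
  over the prime field.\<close>

lemma card_fp_linear_field:
  assumes "CARD('a::{field,finite}) = CARD('p::prime_card) ^ h"
  shows "card {f :: 'a ^ 1 \<Rightarrow> 'p mod_ring. fp_linear f} = CARD('a)"
proof -
  interpret V: vector_space "fp_scale :: 'p mod_ring \<Rightarrow> 'a ^ 1 \<Rightarrow> 'a ^ 1"
    by (rule vector_space_fp_scale[OF assms])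
  interpret F: vector_space_pair "fp_scale :: 'p mod_ring \<Rightarrow> 'a ^ 1 \<Rightarrow> 'a ^ 1"
    "(*) :: 'p mod_ring \<Rightarrow> 'p mod_ring \<Rightarrow> 'p mod_ring"
    by unfold_locales
  \<comment> \<open>Take \<open>{0}\<close> as the subspace: every linear map vanishes on
    it.\<close>
  show ?thesis
    using card_fp_linear_vanishing_on[OF assms V.subspace_single_0]
    by (simp add: F.linear_0 cong: conj_cong)
qed

text \<open>This map reads \<open>f\<close> along the line of \<open>v\<close>, and it is zero
  exactly when \<open>v\<close> lies in \<open>line_kernel f\<close>. A line kernel thus becomes the
  kernel of a map into the functionals on the field, of which there are only q.\<close>

lemma fp_linear_along_line:
  fixes f :: "'a::{field,finite} ^ 'n \<Rightarrow> 'p::prime_card mod_ring"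
  assumes "CARD('a) = CARD('p) ^ h" and "fp_linear f"
  shows "fp_linear (\<lambda>x :: 'a ^ 1. f (x $ 1 *s v))"
proof -
  interpret W: vector_space "fp_scale :: 'p mod_ring \<Rightarrow> 'a ^ 1 \<Rightarrow> 'a ^ 1"
    by (rule vector_space_fp_scale[OF assms(1)])
  interpret f: Vector_Spaces.linear fp_scale "(*)" f by fact
  show ?thesis
  proof unfold_locales
    fix x y :: "'a ^ 1" and c :: "'p mod_ring"
    show "f ((x + y) $ 1 *s v) = f (x $ 1 *s v) + f (y $ 1 *s v)"
      by (simp add: vector_sadd_rdistrib f.add)
    have "fp_scale c x $ 1 *s v = fp_scale c (x $ 1 *s v)"
      by (simp add: fp_scale_def vector_smult_assoc)
    then show "f (fp_scale c x $ 1 *s v) = c * f (x $ 1 *s v)"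
      by (simp add: f.scale)
  qed
qed

text \<open>The intersection is the kernel of the map sending \<open>v\<close> to the two
  functionals that read \<open>f\<close> and \<open>g\<close> along its line. There are q^2 such
  pairs, so the codimension is at most two.\<close>

lemma card_line_kernel_Int_ge:
  fixes f g :: "'a::{field,finite} ^ 'n \<Rightarrow> 'p::prime_card mod_ring"
  assumes "CARD('a) = CARD('p) ^ h" and f: "fp_linear f" and g: "fp_linear g"
  shows "CARD('a) ^ CARD('n) \<le> card (line_kernel f \<inter> line_kernel g) * CARD('a) ^ 2"
proof -
  interpret f: Vector_Spaces.linear fp_scale "(*)" f by fact
  interpret g: Vector_Spaces.linear fp_scale "(*)" g by fact
  let ?\<phi> = "\<lambda>v. (\<lambda>x :: 'a ^ 1. f (x $ 1 *s v), \<lambda>x :: 'a ^ 1. g (x $ 1 *s v))"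
  let ?T = "{f :: 'a ^ 1 \<Rightarrow> 'p mod_ring. fp_linear f}"
  have "CARD('a ^ 'n) \<le> card {v. ?\<phi> v = ?\<phi> 0} * card (?T \<times> ?T)"
  proof (rule card_le_card_kernel_times)
    show "?\<phi> (v - w) = ?\<phi> 0" if "?\<phi> v = ?\<phi> w" for v w
      using that by (auto simp: fun_eq_iff vector_ssub_ldistrib f.diff g.diff f.zero g.zero)
    show "range ?\<phi> \<subseteq> ?T \<times> ?T"
      using fp_linear_along_line[OF assms(1) f] fp_linear_along_line[OF assms(1) g] by auto
  qed auto
  moreover have "{v. ?\<phi> v = ?\<phi> 0} = line_kernel f \<inter> line_kernel g"
    by (auto simp: line_kernel_def fun_eq_iff f.zero g.zero forall_vector_1
        dest: spec[of _ "vec _"])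
  ultimately show ?thesis
    by (simp add: card_fp_linear_field[OF assms(1)] card_cartesian_product power2_eq_square)
qed

text \<open>The p - 1 nonzero multiples of a nonzero \<open>f\<close> are distinct and have the same
  line kernel, so every fibre of \<open>line_kernel\<close> on the nonzero members of
  \<open>A\<close> has at least p - 1 elements.\<close>

lemma card_line_kernels_le:
  fixes A :: "('a::{field,finite} ^ 'n \<Rightarrow> 'p::prime_card mod_ring) set"
  assumes "\<And>f c. f \<in> A \<Longrightarrow> (\<lambda>v. c * f v) \<in> A"
  shows "card (line_kernel ` (A - {\<lambda>_. 0})) * (CARD('p) - 1) \<le> card (A - {\<lambda>_. 0})"
proof -
  let ?S = "A - {\<lambda>_. 0}"
  have "CARD('p) - 1 \<le> card {g \<in> ?S. line_kernel g = H}" if H: "H \<in> line_kernel ` ?S" for H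
  proof -
    obtain f where f: "f \<in> ?S" "H = line_kernel f"
      using H by blast
    then obtain v where v: "f v \<noteq> 0"
      by auto
    have "card (UNIV - {0 :: 'p mod_ring}) \<le> card {g \<in> ?S. line_kernel g = H}"
    proof (rule card_inj_on_le)
      show "inj_on (\<lambda>c v. c * f v) (UNIV - {0})"
        using v by (auto simp: inj_on_def dest!: fun_cong[of _ _ v])
      show "(\<lambda>c v. c * f v) ` (UNIV - {0}) \<subseteq> {g \<in> ?S. line_kernel g = H}"
        using f assms v by (auto simp: line_kernel_def dest: fun_cong[of _ _ v])
    qed auto
    then show ?thesis
      by (simp add: card_Diff_singleton)
  qed
  then have "(\<Sum>H\<in>line_kernel ` ?S. CARD('p) - 1)
      \<le> (\<Sum>H\<in>line_kernel ` ?S. card {g \<in> ?S. line_kernel g = H})"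
    by (rule sum_mono)
  also have "\<dots> = card ?S"
    using sum.image_gen[of ?S "\<lambda>_. 1::nat" line_kernel] by simp
  finally show ?thesis by simp
qed

section \<open>Covering the points of the linear set by hyperplanes\<close>

lemma ex_fp_linear_vanishing_on:
  fixes U :: "('a::{field,finite} ^ 'n) set"
  assumes q: "CARD('a) = CARD('p::prime_card) ^ h"
    and U: "module.subspace (fp_scale :: 'p mod_ring \<Rightarrow> 'a ^ 'n \<Rightarrow> _) U"
    and card: "card U * CARD('a) = CARD('a) ^ CARD('n)"
    and u: "u \<in> U" "u \<noteq> 0"
  obtains f :: "'a ^ 'n \<Rightarrow> 'p::prime_card mod_ring" where "fp_linear f" "\<And>y. y \<in> U \<Longrightarrow> f y = 0"
    "f \<noteq> (\<lambda>_. 0)" "vec.span {u} \<subseteq> line_kernel f"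
proof -
  interpret V: vector_space "fp_scale :: 'p mod_ring \<Rightarrow> 'a ^ 'n \<Rightarrow> 'a ^ 'n"
    by (rule vector_space_fp_scale[OF q])
  define \<psi> where "\<psi> = (\<lambda>(y, x). y + x *s u)"
  define S where "S = \<psi> ` (U \<times> UNIV)"
  \<comment> \<open>Because \<open>u\<close> lies both in \<open>U\<close> and on its own line, it
    has two representations. This makes the sum \<open>S\<close> smaller than the product, which has
    the size of the whole space.\<close>
  have "\<not> inj_on \<psi> (U \<times> UNIV)"
  proof
    assume "inj_on \<psi> (U \<times> UNIV)"
    moreover have "\<psi> (u, 0) = \<psi> (0, 1)"
      by (simp add: \<psi>_def)
    moreover have "0 \<in> U"
      using U by (rule V.subspace_0)
    ultimately show False
      using u by (auto dest!: inj_onD)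
  qed
  then have "card S < card (U \<times> (UNIV :: 'a set))"
    unfolding S_def using card_image_le eq_card_imp_inj_on le_neq_implies_less finite by metis
  then have lt: "card S < CARD('a) ^ CARD('n)"
    using card by (simp add: card_cartesian_product)
  have memS: "y + x *s u \<in> S" if "y \<in> U" for x y
    using that by (force simp: S_def \<psi>_def)
  have "V.subspace S"
    unfolding V.subspace_def
  proof (intro conjI ballI allI)
    show "0 \<in> S"
      using memS[OF V.subspace_0[OF U], of 0] by simp
  next
    fix v w assume "v \<in> S" "w \<in> S"
    then obtain y x y' x' where "v = y + x *s u" "w = y' + x' *s u" "y \<in> U" "y' \<in> U"
      by (auto simp: S_def \<psi>_def)
    then show "v + w \<in> S"
      using memS[of "y + y'" "x + x'"] V.subspace_add[OF U]
      by (simp add: vector_sadd_rdistrib algebra_simps)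
  next
    fix c :: "'p mod_ring" and v assume "v \<in> S"
    then obtain y x where v: "v = y + x *s u" and y: "y \<in> U"
      by (auto simp: S_def \<psi>_def)
    show "fp_scale c v \<in> S"
      using memS[OF V.subspace_scale[OF U y], of c "of_int (to_int_mod_ring c) * x"] v
      by (simp add: fp_scale_def vector_add_ldistrib vector_smult_assoc)
  qed
  let ?X = "{f :: 'a ^ 'n \<Rightarrow> 'p mod_ring. fp_linear f \<and> (\<forall>v\<in>S. f v = 0)}"
  \<comment> \<open>If only the zero functional vanished on \<open>S\<close>, the product formula
    would make \<open>S\<close> as large as the whole space.\<close>
  have "\<not> ?X \<subseteq> {\<lambda>_. 0}"
  proof
    assume "?X \<subseteq> {\<lambda>_. 0}"
    from card_mono[OF _ this] have "card ?X * card S \<le> 1 * card S"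
      by (intro mult_right_mono) simp_all
    then show False
      using card_fp_linear_vanishing_on[OF q \<open>V.subspace S\<close>] lt by linarith
  qed
  then obtain f :: "'a ^ 'n \<Rightarrow> 'p mod_ring"
    where f: "fp_linear f" "\<And>v. v \<in> S \<Longrightarrow> f v = 0" "f \<noteq> (\<lambda>_. 0)"
    by blast
  show thesis
  proof
    show "f y = 0" if "y \<in> U" for y
      using f(2) memS[OF that, of 0] by simp
    show "vec.span {u} \<subseteq> line_kernel f"
      using f(2) memS[OF V.subspace_0[OF U]]
      by (auto simp: line_kernel_def vec.span_singleton vector_smult_assoc)
  qed (use f in auto)
qed

text \<open>Here \<open>k\<close> is m - 1 and \<open>N\<close> is the number of hyperplanes in the
  cover. Nonzero vectors are counted instead of points: each point has q - 1 of them, and the final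
  \<open>- 1\<close> removes the zero vector from the union.\<close>

lemma card_points_of_fp_subspace_le:
  fixes U :: "('a::{field,finite} ^ 'n) set"
  assumes q: "CARD('a) = CARD('p::prime_card) ^ h" and n: "CARD('n) = Suc (Suc k)"
    and U: "module.subspace (fp_scale :: 'p mod_ring \<Rightarrow> 'a ^ 'n \<Rightarrow> _) U"
    and cardU: "card U = CARD('a) ^ Suc k"
  obtains N where "1 \<le> N" "N * (CARD('p) - 1) \<le> CARD('a) - 1"
    "card (points_of U) * (CARD('a) - 1)
      \<le> CARD('a) ^ Suc k + (N - 1) * (CARD('a) ^ Suc k - CARD('a) ^ k) - 1"
proof -
  let ?q = "CARD('a)"
  define A where "A = {f :: 'a ^ 'n \<Rightarrow> 'p mod_ring. fp_linear f \<and> (\<forall>u\<in>U. f u = 0)}"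
  define F where "F = line_kernel ` (A - {\<lambda>_. 0})"
  have q1: "?q > 1"
    using card_mono[of UNIV "{0, 1 :: 'a}"] by simp
  interpret V: vector_space "fp_scale :: 'p mod_ring \<Rightarrow> 'a ^ 'n \<Rightarrow> 'a ^ 'n"
    by (rule vector_space_fp_scale[OF q])
  interpret P: vector_space_pair "fp_scale :: 'p mod_ring \<Rightarrow> 'a ^ 'n \<Rightarrow> 'a ^ 'n"
    "(*) :: 'p mod_ring \<Rightarrow> 'p mod_ring \<Rightarrow> 'p mod_ring"
    by unfold_locales
  have zeroA: "(\<lambda>_. 0) \<in> A"
    using P.linear_zero by (simp add: A_def)
  \<comment> \<open>The annihilator of \<open>U\<close> has q^(k+2) / q^(k+1) = q elements.\<close>
  have cardA: "card (A - {\<lambda>_. 0}) = ?q - 1"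
    using card_fp_linear_vanishing_on[OF q U] cardU n q1 zeroA by (simp add: A_def)
  \<comment> \<open>The hyperplane of \<open>f0\<close> serves as the first member of the
    union.\<close>
  then obtain f0 where f0: "f0 \<in> A - {\<lambda>_. 0}"
    using q1 by (metis card.empty equals0I zero_less_diff less_numeral_extra(3))
  have add: "f (x + y) = f x + f y" if "f \<in> A" for f x y
    using that P.linear_add by (simp add: A_def)
  have le: "card H \<le> ?q ^ Suc k" if H: "H \<in> F" for H
  proof -
    obtain f v where f: "f \<in> A" "H = line_kernel f" "f v \<noteq> 0"
      using H unfolding F_def by blast
    then show ?thesis
      using card_line_kernel_le[of f v] add[OF f(1)] n by simp
  qed
  have "?q ^ k \<le> card (H \<inter> line_kernel f0)" if H: "H \<in> F" for H
  proof -
    obtain f where "f \<in> A" "H = line_kernel f"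
      using H by (auto simp: F_def)
    then have "?q ^ k * ?q ^ 2 \<le> card (H \<inter> line_kernel f0) * ?q ^ 2"
      using card_line_kernel_Int_ge[OF q, of f f0] f0 n
      by (simp add: A_def power2_eq_square mult_ac)
    then show ?thesis
      using q1 by simp
  qed
  then have W: "card (\<Union>F) \<le> ?q ^ Suc k + (card F - 1) * (?q ^ Suc k - ?q ^ k)"
    using le f0 by (intro card_Union_le) (auto simp: F_def)
  have sub: "Q \<subseteq> \<Union>F" if Q: "Q \<in> points_of U" for Q
  proof -
    obtain u where u: "Q = vec.span {u}" "u \<in> U" "u \<noteq> 0"
      using Q by (auto simp: points_of_def)
    have "card U * ?q = ?q ^ CARD('n)"
      by (simp add: cardU n)
    from ex_fp_linear_vanishing_on[OF q U this u(2,3)]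
    obtain f :: "'a ^ 'n \<Rightarrow> 'p mod_ring" where "fp_linear f" "\<And>y. y \<in> U \<Longrightarrow> f y = 0"
      "f \<noteq> (\<lambda>_. 0)" "Q \<subseteq> line_kernel f"
      using u(1) by blast
    then have "line_kernel f \<in> F"
      by (auto simp: F_def A_def)
    with \<open>Q \<subseteq> line_kernel f\<close> show ?thesis
      by blast
  qed
  have "0 \<in> line_kernel f0"
    using subspace_line_kernel[of f0] add f0 by (intro vec.subspace_0) auto
  then have "0 \<in> \<Union>F"
    using f0 by (auto simp: F_def)
  from card_points_of_le[OF sub this] W
  have "card (points_of U) * (?q - 1)
      \<le> ?q ^ Suc k + (card F - 1) * (?q ^ Suc k - ?q ^ k) - 1"
    by (meson diff_le_mono le_trans)
  moreover have "1 \<le> card F"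
    using f0 by (auto simp: F_def Suc_le_eq card_gt_0_iff)
  moreover have "(\<lambda>v. c * f v) \<in> A" if "f \<in> A" for f and c :: "'p mod_ring"
    using that P.linear_compose_scale_right[of f c] by (auto simp: A_def)
  then have "card F * (CARD('p) - 1) \<le> ?q - 1"
    unfolding F_def using card_line_kernels_le[of A] cardA by simp
  ultimately show thesis
    by (intro that[of "card F"])
qed

section \<open>The bound over the reals\<close>

theorem theorem3p4:
  fixes p q h m :: nat
    and L :: "('a::{field,finite} ^ 'n) set set"
  assumes "prime p" and "CARD('p::prime_card) = p"
    and "q = p ^ h" and "CARD('a) = q"
    and "CARD('n) = m + 1"
    and "fp_linear_set TYPE('p) (h * m) L"
  shows "real (card L) \<le>
    real q powi (int m - 1) * ((real q - 1) / (real p - 1))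
      + (real q powi (int m - 1) - 1) / (real q - 1)"
proof -
  have card_a: "CARD('a) = CARD('p) ^ h"
    using assms by simp
  interpret V: vector_space "fp_scale :: 'p mod_ring \<Rightarrow> 'a ^ 'n \<Rightarrow> 'a ^ 'n"
    by (rule vector_space_fp_scale[OF card_a])
  obtain U where U: "V.subspace U" "V.dim U = h * m" "L = points_of U"
    using assms(6) by (auto simp: fp_linear_set_def)
  have "card U = q ^ m"
    using V.card_subspace_eq_power_dim[OF _ _ U(1)] U(2) assms(2,3) by (simp add: power_mult)
  have p2: "p \<ge> 2"
    using assms(1) by (rule prime_ge_2_nat)
  have q2: "q \<ge> 2"
    using card_mono[of UNIV "{0, 1 :: 'a}"] assms(4) by simp
  then have "h \<noteq> 0"
    using assms(3) by (intro notI) simp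
  then have pq: "p \<le> q"
    using assms(3) p2 by (simp add: self_le_power)
  show ?thesis
  proof (cases m)
    \<comment> \<open>Now \<open>L\<close> is empty and the exponent is -1, so the right-hand side
      is q^(-1) ((q - 1) / (p - 1) - 1), which is nonnegative because p \<le> q.\<close>
    case 0
    then have "card U = 1"
      using \<open>card U = q ^ m\<close> by simp
    then have "U = {0}"
      using V.subspace_0[OF U(1)] by (auto simp: card_1_singleton_iff)
    then have "card L = 0"
      by (simp add: U(3) points_of_def)
    moreover have "1 \<le> (real q - 1) / (real p - 1)"
      using pq p2 by simp
    then have "inverse (real q) * 1 \<le> inverse (real q) * ((real q - 1) / (real p - 1))"
      by (intro mult_left_mono) auto
    moreover have "(inverse (real q) - 1) / (real q - 1) = - inverse (real q)"
      using q2 by (simp add: field_simps)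
    ultimately show ?thesis
      using 0 by (simp add: power_int_minus)
  next
    case (Suc k)
    obtain N where N: "1 \<le> N" "N * (p - 1) \<le> q - 1"
      "card L * (q - 1) \<le> q ^ Suc k + (N - 1) * (q ^ Suc k - q ^ k) - 1"
      using card_points_of_fp_subspace_le[OF card_a _ U(1), of k] \<open>card U = q ^ m\<close> Suc assms(2,4,5) U(3)
      by auto
    have "real (N * (p - 1)) \<le> real (q - 1)"
      using N(2) by linarith
    then have "real N * (real p - 1) \<le> real q - 1"
      using p2 q2 by (simp add: of_nat_diff)
    then have N_le: "real N \<le> (real q - 1) / (real p - 1)"
      using p2 by (simp add: pos_le_divide_eq)
    \<comment> \<open>None of the natural-number subtractions is truncated, so the bound carries
      over to the reals unchanged.\<close>
    have cast: "real (a + (N - 1) * (a - b) - 1) = real a + (real N - 1) * (real a - real b) - 1"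
      if "b \<le> a" "1 \<le> a" for a b
      using that N(1) trans_le_add1[OF that(2), of "(N - 1) * (a - b)"] by (simp add: of_nat_diff)
    have "real (card L * (q - 1)) \<le> real (q ^ Suc k + (N - 1) * (q ^ Suc k - q ^ k) - 1)"
      using N(3) of_nat_mono by blast
    moreover have "q ^ k \<le> q ^ Suc k" "1 \<le> q ^ Suc k"
      using q2 by simp_all
    ultimately have "real (card L) * (real q - 1)
        \<le> real q ^ Suc k + (real N - 1) * (real q ^ Suc k - real q ^ k) - 1"
      using cast[of "q ^ k" "q ^ Suc k"] q2 by (simp add: of_nat_diff)
    \<comment> \<open>Regrouped so that division by q - 1 gives the two summands of the bound, with
      \<open>N\<close> still in place of (q - 1) / (p - 1).\<close>
    also have "\<dots> = (real N * real q ^ k) * (real q - 1) + (real q ^ k - 1)"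
      by (simp add: algebra_simps)
    finally have "real (card L) \<le> real N * real q ^ k + (real q ^ k - 1) / (real q - 1)"
      using q2 by (simp add: field_simps)
    also have "real N * real q ^ k \<le> real q ^ k * ((real q - 1) / (real p - 1))"
      using mult_left_mono[OF N_le, of "real q ^ k"] by (simp add: mult_ac)
    finally show ?thesis
      using Suc by simp
  qed
qed

end
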